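(* Let $A$ be the associative triple system of $2\times2$ matrices over $\mathbb{Q}$ and let $U(A^C)$ be its universal associative enveloping algebra with respect to the special commutator. The Wedderburn decomposition of $U(A^C)$ is $$U(A^C)=\mathbb{Q}\oplus M_{2\times2}(\mathbb{Q})\oplus M_{2\times2}(\mathbb{Q}),$$ where $M_{2\times2}(\mathbb{Q})$ is the ordinary associative algebra of $2\times2$ matrices.
   Context: $A=M_2(F)$, here with $F=\mathbb{Q}$, with triple product the ordinary matrix product $xyz$ and special commutator $[x,y,z]=xyz-yxz$. Let $E_{ij}$ ($1\le i,j\le2$) be the matrix units, $X=\{e_{ij}\mid1\le i,j\le2\}$ a set of symbols, $F\langle X\rangle$ the free unital associative algebra on $X$, and $\eta\colon A\to F\langle X\rangle$ the linear map with $\eta(E_{ij})=e_{ij}$. Then $U(A^C)=F\langle X\rangle/I^C$, where $I^C$ is the two-sided ideal generated by all elements $e_{ij}e_{kl}e_{st}-e_{kl}e_{ij}e_{st}-\eta([E_{ij},E_{kl},E_{st}])$ with indices in $\{1,2\}$. *)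

theory Defs
  imports
    "HOL-Analysis.Analysis"
    "HOL-Library.Poly_Mapping"
    "HOL-Algebra.Module"
    "HOL-Algebra.QuotRing"
    "HOL-Algebra.Chinese_Remainder"
begin

section \<open>Algebras over the rationals\<close>

text \<open>
  A unital associative algebra over the rationals is represented by the record type
  \<^type>\<open>module\<close> of HOL-Algebra, i.e. a ring together with a scalar multiplication.
\<close>

definition alg_iso ::
  "(rat, 'a, 'm) module_scheme \<Rightarrow> (rat, 'b, 'n) module_scheme \<Rightarrow> ('a \<Rightarrow> 'b) set" where
  "alg_iso A B =
     {f \<in> ring_iso A B. \<forall>c. \<forall>x\<in>carrier A. f (c \<odot>\<^bsub>A\<^esub> x) = c \<odot>\<^bsub>B\<^esub> f x}"

definition alg_isomorphic ::
  "(rat, 'a, 'm) module_scheme \<Rightarrow> (rat, 'b, 'n) module_scheme \<Rightarrow> bool" where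
  "alg_isomorphic A B \<longleftrightarrow> alg_iso A B \<noteq> {}"

text \<open>
  In a unital algebra every two-sided ring ideal is closed under scalar multiplication,
  so the ring-theoretic \<^const>\<open>ideal\<close> and \<^const>\<open>genideal\<close> are also the notions for algebras.
\<close>

definition simple_alg :: "(rat, 'a, 'm) module_scheme \<Rightarrow> bool" where
  "simple_alg A \<longleftrightarrow> carrier A \<noteq> {\<zero>\<^bsub>A\<^esub>} \<and> (\<forall>I. ideal I A \<longrightarrow> I = {\<zero>\<^bsub>A\<^esub>} \<or> I = carrier A)"

text \<open>Scalar multiplication on cosets is written in the style of \<^const>\<open>rcoset_mult\<close>.\<close>

definition quot_alg ::
  "(rat, 'a, 'm) module_scheme \<Rightarrow> 'a set \<Rightarrow> (rat, 'a set) module" where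
  "quot_alg A I =
     ring.extend (A Quot I) \<lparr> smult = (\<lambda>c X. \<Union>x\<in>X. I +>\<^bsub>A\<^esub> (c \<odot>\<^bsub>A\<^esub> x)) \<rparr>"

definition sum_alg ::
  "(rat, 'a, 'm) module_scheme \<Rightarrow> (rat, 'b, 'n) module_scheme \<Rightarrow> (rat, 'a \<times> 'b) module"
  (infixr \<open>\<oplus>\<^sub>a\<^sub>l\<^sub>g\<close> 65) where
  "A \<oplus>\<^sub>a\<^sub>l\<^sub>g B =
     ring.extend (RDirProd A B) \<lparr> smult = (\<lambda>c (a, b). (c \<odot>\<^bsub>A\<^esub> a, c \<odot>\<^bsub>B\<^esub> b)) \<rparr>"

definition rat_alg :: "(rat, rat) module" where
  "rat_alg = \<lparr> carrier = UNIV, mult = (*), one = 1, zero = 0, add = (+), smult = (*) \<rparr>"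

text \<open>
  The unit is \<^term>\<open>mat 1\<close> and the product is \<^term>\<open>(**)\<close>; the type class constants \<^term>\<open>1\<close>
  and \<^term>\<open>(*)\<close> on \<^type>\<open>vec\<close> are the componentwise ones.
  The two elements of the index type \<^typ>\<open>2\<close> are \<^term>\<open>1::2\<close> and \<^term>\<open>2::2\<close>, the latter equal
  to \<^term>\<open>0::2\<close>.
\<close>

definition mat2_alg :: "(rat, rat^2^2) module" where
  "mat2_alg = \<lparr> carrier = UNIV, mult = (**), one = mat 1, zero = 0, add = (+),
                smult = (\<lambda>c M. \<chi> i j. c * M $ i $ j) \<rparr>"

section \<open>The free unital associative algebra\<close>

text \<open>
  Lists over \<^typ>\<open>'x\<close> form the free monoid on \<^typ>\<open>'x\<close>. It is written additively because
  \<^type>\<open>poly_mapping\<close> takes its convolution product from an additive monoid of exponents; hence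
  \<^typ>\<open>'x list \<Rightarrow>\<^sub>0 rat\<close> is the monoid algebra of the free monoid, with noncommuting symbols.
\<close>

instantiation list :: (type) monoid_add
begin

definition zero_list :: "'a list" where "0 = []"

definition plus_list :: "'a list \<Rightarrow> 'a list \<Rightarrow> 'a list" where "xs + ys = xs @ ys"

instance
  by standard (simp_all add: zero_list_def plus_list_def)

end

definition free_alg :: "(rat, 'x list \<Rightarrow>\<^sub>0 rat) module" where
  "free_alg = \<lparr> carrier = UNIV, mult = (*), one = 1, zero = 0, add = (+),
                smult = (\<lambda>c. Poly_Mapping.map ((*) c)) \<rparr>"

section \<open>The triple system and its universal associative envelope\<close>

definition triple :: "rat^2^2 \<Rightarrow> rat^2^2 \<Rightarrow> rat^2^2 \<Rightarrow> rat^2^2" where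
  "triple x y z = x ** y ** z"

definition special_comm :: "rat^2^2 \<Rightarrow> rat^2^2 \<Rightarrow> rat^2^2 \<Rightarrow> rat^2^2" where
  "special_comm x y z = triple x y z - triple y x z"

definition matrix_unit :: "2 \<Rightarrow> 2 \<Rightarrow> rat^2^2" where
  "matrix_unit i j = (\<chi> k l. if k = i \<and> l = j then 1 else 0)"

text \<open>The symbol \<open>e\<^sub>i\<^sub>j\<close> is the one-letter word \<^term>\<open>[(i, j)]\<close>.\<close>

definition symb :: "2 \<Rightarrow> 2 \<Rightarrow> (2 \<times> 2) list \<Rightarrow>\<^sub>0 rat" where
  "symb i j = Poly_Mapping.single [(i, j)] 1"

definition eta :: "rat^2^2 \<Rightarrow> (2 \<times> 2) list \<Rightarrow>\<^sub>0 rat" where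
  "eta M = (\<Sum>i\<in>UNIV. \<Sum>j\<in>UNIV. M $ i $ j \<odot>\<^bsub>free_alg\<^esub> symb i j)"

definition special_comm_ideal :: "((2 \<times> 2) list \<Rightarrow>\<^sub>0 rat) set" where
  "special_comm_ideal =
     Idl\<^bsub>free_alg\<^esub>
       {symb i j * symb k l * symb s t - symb k l * symb i j * symb s t
          - eta (special_comm (matrix_unit i j) (matrix_unit k l) (matrix_unit s t))
        | i j k l s t. True}"

definition universal_envelope :: "(rat, ((2 \<times> 2) list \<Rightarrow>\<^sub>0 rat) set) module" where
  "universal_envelope = quot_alg free_alg special_comm_ideal"

text \<open>\<^const>\<open>eta\<close> is the linear map that sends each matrix unit to the corresponding symbol.\<close>

lemma lookup_free_smult:
  "Poly_Mapping.lookup (c \<odot>\<^bsub>free_alg\<^esub> p) w = c * Poly_Mapping.lookup p w"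
  by (simp add: free_alg_def map.rep_eq when_def)

lemma eta_matrix_unit: "eta (matrix_unit i j) = symb i j"
proof -
  have *: "matrix_unit i j $ k $ l \<odot>\<^bsub>free_alg\<^esub> symb k l
             = (if k = i then if l = j then symb i j else 0 else 0)" for k l
    by (rule poly_mapping_eqI) (simp add: lookup_free_smult matrix_unit_def)
  have "(\<Sum>l\<in>UNIV. matrix_unit i j $ k $ l \<odot>\<^bsub>free_alg\<^esub> symb k l)
          = (if k = i then symb i j else 0)" for k
    unfolding * by (cases "k = i") simp_all
  then show ?thesis
    by (simp add: eta_def)
qed

lemma eta_add: "eta (M + N) = eta M + eta N"
  unfolding eta_def sum.distrib [symmetric]
  by (intro sum.cong refl poly_mapping_eqI)
     (simp add: lookup_free_smult lookup_add algebra_simps)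

lemma eta_smult: "eta (c \<odot>\<^bsub>mat2_alg\<^esub> M) = c \<odot>\<^bsub>free_alg\<^esub> eta M"
  by (rule poly_mapping_eqI)
     (simp add: eta_def mat2_alg_def sum_2 lookup_free_smult lookup_add algebra_simps)

end

theory Submission
  imports Defs
begin

text \<open>
  Write \<open>e x\<close> for the class of \<^term>\<open>eta x\<close> in the envelope \<open>U\<close> and \<open>s = e 1\<close> for the class of
  the identity matrix. The defining relations say \<open>[e x, e y] e z = e ([x, y] z)\<close>. Three maps
  \<open>e x \<mapsto> c x\<close> respect them: \<open>c = 1\<close> and \<open>c = - 1\<close>, because \<open>c\<^sup>3 = c\<close>, and \<open>c = 0\<close>, which
  extends to words as the constant term. Together they give an algebra homomorphism from the free algebra to
  \<open>\<rat> \<oplus> M\<^sub>2 \<oplus> M\<^sub>2\<close> with \<open>e x \<mapsto> (0, x, - x)\<close>, whose kernel contains the ideal of relations. What has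
  to be shown is that \<open>U\<close> is no larger than dimension \<open>1 + 4 + 4\<close>.

  The relation with \<open>x = 1\<close> gives \<open>s (e y) (e z) = (e y) s (e z)\<close>, so \<open>s\<close> moves past a factor \<open>e y\<close>
  as long as a further factor follows on the right. For a commutator \<open>d = [a, b]\<close> the relation with
  \<open>z = 1\<close> reads \<open>e d = [e a, e b] s\<close>. Hence
    \<open>(e d) (e c) = [e a, e b] s (e c) = s [e a, e b] (e c) = s (e (d c))\<close>.
  As \<open>(e 1) (e c) = s (e (1 c))\<close> trivially and every matrix is a scalar plus a combination of
  commutators, the product rule \<open>(e x) (e c) = s (e (x c))\<close> holds for all \<open>x\<close> and \<open>c\<close>
  (\<open>eta_mult_eta\<close>). In particular \<open>s\<close> is central. Inserting the product rule in the defining relation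
  gives \<open>s\<^sup>2 (e ([a, b] c)) = e ([a, b] c)\<close>, and every matrix has the form \<open>[a, b] c\<close>, so \<open>s\<^sup>2\<close> acts
  as the identity on all \<open>e x\<close> (\<open>eta_one_square\<close>). Now every word reduces to a combination of \<open>1\<close>,
  \<open>e x\<close> and \<open>s (e y)\<close> (\<open>normal_form\<close>). The homomorphism sends \<open>\<alpha> + e x + s (e y)\<close> to
  \<open>(\<alpha>, \<alpha> + x + y, \<alpha> - x + y)\<close>, from which \<open>\<alpha>\<close>, \<open>x\<close> and \<open>y\<close> can be recovered: it is injective on
  normal forms, and it is onto.
\<close>

lemma abelian_group_type:
  fixes R :: "('a::ab_group_add, 'm) ring_scheme"
  assumes "carrier R = UNIV" "zero R = 0" "add R = (+)"
  shows "abelian_group R"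
proof (rule abelian_groupI)
  fix x assume "x \<in> carrier R"
  show "\<exists>y\<in>carrier R. y \<oplus>\<^bsub>R\<^esub> x = \<zero>\<^bsub>R\<^esub>"
    by (rule bexI[of _ "- x"]) (simp_all add: assms)
qed (simp_all add: assms ac_simps)

section \<open>Two by two matrices\<close>

lemma smult_matrix_nth: "(c \<odot>\<^bsub>mat2_alg\<^esub> M) $ i $ j = c * M $ i $ j"
  by (simp add: mat2_alg_def)

lemma smult_one_matrix: "1 \<odot>\<^bsub>mat2_alg\<^esub> M = M"
  by (simp add: vec_eq_iff smult_matrix_nth)

lemma smult_matrix_mult_left: "(c \<odot>\<^bsub>mat2_alg\<^esub> M) ** N = c \<odot>\<^bsub>mat2_alg\<^esub> (M ** N)"
  by (simp add: vec_eq_iff smult_matrix_nth matrix_matrix_mult_def sum_distrib_left mult.assoc)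

lemma smult_matrix_mult_right: "M ** (c \<odot>\<^bsub>mat2_alg\<^esub> N) = c \<odot>\<^bsub>mat2_alg\<^esub> (M ** N)"
  by (simp add: vec_eq_iff smult_matrix_nth matrix_matrix_mult_def sum_distrib_left mult.left_commute)

lemma matrix_mult_add_left: "((M::rat^2^2) + N) ** K = M ** K + N ** K"
  by (simp add: vec_eq_iff matrix_matrix_mult_def sum_2 algebra_simps)

lemma matrix_mult_diff_left: "((M::rat^2^2) - N) ** K = M ** K - N ** K"
  by (simp add: vec_eq_iff matrix_matrix_mult_def sum_2 algebra_simps)

lemma matrix_unit_mult:
  "matrix_unit i j ** matrix_unit k l = (if j = k then matrix_unit i l else 0)"
  using exhaust_2[of i] exhaust_2[of j] exhaust_2[of k] exhaust_2[of l]
  by (auto simp: vec_eq_iff matrix_matrix_mult_def matrix_unit_def sum_2 forall_2)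

text \<open>
  Multiplying by matrix units on both sides isolates a single entry; this is what makes the matrix
  algebra simple.
\<close>

lemma matrix_unit_sandwich:
  "matrix_unit k i ** M ** matrix_unit j l = M $ i $ j \<odot>\<^bsub>mat2_alg\<^esub> matrix_unit k l"
  using exhaust_2[of i] exhaust_2[of j] exhaust_2[of k] exhaust_2[of l]
  by (auto simp: vec_eq_iff matrix_matrix_mult_def matrix_unit_def sum_2 forall_2 smult_matrix_nth)

lemma matrix_unit_expansion:
  "M = M $ 1 $ 1 \<odot>\<^bsub>mat2_alg\<^esub> matrix_unit 1 1 + M $ 1 $ 2 \<odot>\<^bsub>mat2_alg\<^esub> matrix_unit 1 2
     + (M $ 2 $ 1 \<odot>\<^bsub>mat2_alg\<^esub> matrix_unit 2 1 + M $ 2 $ 2 \<odot>\<^bsub>mat2_alg\<^esub> matrix_unit 2 2)"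
  by (simp add: vec_eq_iff forall_2 smult_matrix_nth matrix_unit_def)

text \<open>
  The matrix units span, so a property that is stable under linear combinations need only be
  checked on them.
\<close>

lemma matrix_span_induct [case_names add smult unit]:
  assumes "\<And>M N. P M \<Longrightarrow> P N \<Longrightarrow> P (M + N)"
    and "\<And>c M. P M \<Longrightarrow> P (c \<odot>\<^bsub>mat2_alg\<^esub> M)"
    and "\<And>i j. P (matrix_unit i j)"
  shows "P M"
  by (rule ssubst[where P = P, OF matrix_unit_expansion]) (intro assms)

text \<open>
  A matrix is half its trace times the identity plus a traceless matrix, and the traceless matrices
  are spanned by the commutators \<open>[E\<^sub>1\<^sub>1, E\<^sub>1\<^sub>2] = E\<^sub>1\<^sub>2\<close>, \<open>[E\<^sub>2\<^sub>2, E\<^sub>2\<^sub>1] = E\<^sub>2\<^sub>1\<close> and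
  \<open>[E\<^sub>1\<^sub>2, E\<^sub>2\<^sub>1] = E\<^sub>1\<^sub>1 - E\<^sub>2\<^sub>2\<close>.
\<close>

lemma matrix_commutator_induct [case_names add smult one commutator]:
  assumes add: "\<And>M N. P M \<Longrightarrow> P N \<Longrightarrow> P (M + N)"
    and smult: "\<And>c M. P M \<Longrightarrow> P (c \<odot>\<^bsub>mat2_alg\<^esub> M)"
    and one: "P (mat 1)"
    and commutator: "\<And>a b. P (a ** b - b ** a)"
  shows "P M"
proof -
  let ?E = matrix_unit
  have "P (?E 1 1 ** ?E 1 2 - ?E 1 2 ** ?E 1 1)"
    by (rule commutator)
  then have E12: "P (?E 1 2)" by (simp add: matrix_unit_mult)
  have "P (?E 2 2 ** ?E 2 1 - ?E 2 1 ** ?E 2 2)"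
    by (rule commutator)
  then have E21: "P (?E 2 1)" by (simp add: matrix_unit_mult)
  have "P (?E 1 2 ** ?E 2 1 - ?E 2 1 ** ?E 1 2)"
    by (rule commutator)
  then have H: "P (?E 1 1 - ?E 2 2)" by (simp add: matrix_unit_mult)
  have "M = ((M $ 1 $ 1 + M $ 2 $ 2) / 2) \<odot>\<^bsub>mat2_alg\<^esub> mat 1
      + ((M $ 1 $ 1 - M $ 2 $ 2) / 2) \<odot>\<^bsub>mat2_alg\<^esub> (?E 1 1 - ?E 2 2)
      + (M $ 1 $ 2 \<odot>\<^bsub>mat2_alg\<^esub> ?E 1 2 + M $ 2 $ 1 \<odot>\<^bsub>mat2_alg\<^esub> ?E 2 1)"
    by (simp add: vec_eq_iff forall_2 smult_matrix_nth matrix_unit_def mat_def field_simps)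
  then show ?thesis
    by (rule ssubst[where P = P]) (intro add smult one H E12 E21)
qed

text \<open>
  A nonzero member \<open>M\<close> of an ideal has an entry \<open>M\<^sub>i\<^sub>j \<noteq> 0\<close>, and then
  \<open>E\<^sub>k\<^sub>l = (1 / M\<^sub>i\<^sub>j) E\<^sub>k\<^sub>i M E\<^sub>j\<^sub>l\<close> lies in the ideal for all \<open>k\<close> and \<open>l\<close>. A scalar multiple is written as a
  product with a scalar matrix so that ring ideals absorb it.
\<close>

lemma simple_alg_mat2: "simple_alg mat2_alg"
  unfolding simple_alg_def
proof (intro conjI allI impI)
  have "(mat 1 :: rat^2^2) \<noteq> 0"
    by (simp add: vec_eq_iff mat_def)
  then show "carrier mat2_alg \<noteq> {\<zero>\<^bsub>mat2_alg\<^esub>}"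
    by (auto simp: mat2_alg_def)
next
  fix I assume "ideal I mat2_alg"
  then interpret ideal I mat2_alg .
  show "I = {\<zero>\<^bsub>mat2_alg\<^esub>} \<or> I = carrier mat2_alg"
  proof (rule disjCI)
    assume "I \<noteq> carrier mat2_alg"
    have zero: "0 \<in> I"
      using additive_subgroup.zero_closed[OF is_additive_subgroup] by (simp add: mat2_alg_def)
    have l: "N ** M \<in> I" and r: "M ** N \<in> I" if "M \<in> I" for M N
      using I_l_closed[OF that, of N] I_r_closed[OF that, of N] by (auto simp: mat2_alg_def)
    have add: "M + N \<in> I" if "M \<in> I" "N \<in> I" for M N
      using additive_subgroup.a_closed[OF is_additive_subgroup that] by (simp add: mat2_alg_def)
    have "M = 0" if "M \<in> I" for M
    proof (rule ccontr)
      assume "M \<noteq> 0"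
      then obtain i j where ij: "M $ i $ j \<noteq> 0"
        by (auto simp: vec_eq_iff)
      have "N \<in> I" for N
      proof (induction N rule: matrix_span_induct)
        case (unit k l)
        have "((1 / M $ i $ j) \<odot>\<^bsub>mat2_alg\<^esub> mat 1) ** (matrix_unit k i ** M ** matrix_unit j l) \<in> I"
          using that l r by blast
        also have "((1 / M $ i $ j) \<odot>\<^bsub>mat2_alg\<^esub> mat 1) ** (matrix_unit k i ** M ** matrix_unit j l)
            = matrix_unit k l"
          using ij by (simp add: matrix_unit_sandwich smult_matrix_mult_left)
            (simp add: vec_eq_iff smult_matrix_nth)
        finally show ?case .
      next
        case (smult c N)
        have "(c \<odot>\<^bsub>mat2_alg\<^esub> mat 1) ** N \<in> I" using smult l by blast
        then show ?case by (simp add: smult_matrix_mult_left)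
      qed (rule add)
      then show False using \<open>I \<noteq> carrier mat2_alg\<close> by (auto simp: mat2_alg_def)
    qed
    with zero show "I = {\<zero>\<^bsub>mat2_alg\<^esub>}" by (auto simp: mat2_alg_def)
  qed
qed

section \<open>The rationals\<close>

lemma simple_alg_rat: "simple_alg rat_alg"
  unfolding simple_alg_def
proof (intro conjI allI impI)
  have "1 \<in> carrier rat_alg" "1 \<noteq> \<zero>\<^bsub>rat_alg\<^esub>"
    by (simp_all add: rat_alg_def)
  then show "carrier rat_alg \<noteq> {\<zero>\<^bsub>rat_alg\<^esub>}"
    by blast
next
  fix I assume "ideal I rat_alg"
  then interpret ideal I rat_alg .
  have zero: "0 \<in> I"
    using additive_subgroup.zero_closed[OF is_additive_subgroup] by (simp add: rat_alg_def)
  have "d \<in> I" if "c \<in> I" "c \<noteq> 0" for c d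
    using I_l_closed[OF that(1), of "d / c"] that(2) by (simp add: rat_alg_def)
  with zero show "I = {\<zero>\<^bsub>rat_alg\<^esub>} \<or> I = carrier rat_alg"
    by (auto simp: rat_alg_def)
qed

section \<open>The free algebra\<close>

lemma ring_free_alg: "ring free_alg"
proof (rule ringI)
  show "abelian_group free_alg"
    by (rule abelian_group_type) (simp_all add: free_alg_def)
  show "Group.monoid free_alg"
    by (rule monoidI) (auto simp: free_alg_def mult.assoc)
qed (auto simp: free_alg_def algebra_simps)

lemma poly_mapping_single_induct [case_names zero add single]:
  fixes p :: "'w \<Rightarrow>\<^sub>0 'c::comm_monoid_add"
  assumes "P 0" and "\<And>p q. P p \<Longrightarrow> P q \<Longrightarrow> P (p + q)"
    and "\<And>w c. P (Poly_Mapping.single w c)"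
  shows "P p"
proof (induction p rule: update_induct)
  case const
  show ?case by (rule assms(1))
next
  case (update p w c)
  have "Poly_Mapping.lookup p w = 0"
    using update(1) by (simp add: in_keys_iff)
  then have "Poly_Mapping.update w c p = Poly_Mapping.single w c + p"
    by (intro poly_mapping_eqI) (auto simp: lookup_update lookup_add lookup_single when_def)
  then show ?case using update assms by simp
qed

lemma single_append:
  "Poly_Mapping.single (u @ v) (c * d :: rat) = Poly_Mapping.single u c * Poly_Mapping.single v d"
  by (simp add: mult_single plus_list_def)

lemma single_empty_one: "Poly_Mapping.single [] (1::rat) = 1"
  by (fold zero_list_def) (rule single_one)

lemma smult_single: "c \<odot>\<^bsub>free_alg\<^esub> Poly_Mapping.single w d = Poly_Mapping.single w (c * d)"
  by (rule poly_mapping_eqI) (simp add: lookup_free_smult lookup_single when_def)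

lemma smult_add: "c \<odot>\<^bsub>free_alg\<^esub> (p + q) = c \<odot>\<^bsub>free_alg\<^esub> p + c \<odot>\<^bsub>free_alg\<^esub> q"
  by (rule poly_mapping_eqI) (simp add: lookup_free_smult lookup_add algebra_simps)

lemma smult_diff: "c \<odot>\<^bsub>free_alg\<^esub> (p - q) = c \<odot>\<^bsub>free_alg\<^esub> p - c \<odot>\<^bsub>free_alg\<^esub> q"
  by (rule poly_mapping_eqI) (simp add: lookup_free_smult lookup_minus algebra_simps)

lemma smult_zero: "c \<odot>\<^bsub>free_alg\<^esub> 0 = 0"
  by (rule poly_mapping_eqI) (simp add: lookup_free_smult)

lemma smult_eq_mult: "c \<odot>\<^bsub>free_alg\<^esub> p = Poly_Mapping.single [] c * p"
proof (induction p rule: poly_mapping_single_induct)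
  case (single w d)
  show ?case by (simp add: smult_single mult_single plus_list_def)
qed (simp_all add: smult_add smult_zero algebra_simps)

lemma scalar_central: "p * Poly_Mapping.single [] (c::rat) = c \<odot>\<^bsub>free_alg\<^esub> p"
proof (induction p rule: poly_mapping_single_induct)
  case (single w d)
  show ?case by (simp add: smult_single mult_single plus_list_def mult.commute[of d])
qed (simp_all add: smult_add smult_zero algebra_simps)

lemma smult_mult_left: "(c \<odot>\<^bsub>free_alg\<^esub> p) * q = c \<odot>\<^bsub>free_alg\<^esub> (p * q)"
  by (simp add: smult_eq_mult mult.assoc)

lemma smult_mult_right: "p * (c \<odot>\<^bsub>free_alg\<^esub> q) = c \<odot>\<^bsub>free_alg\<^esub> (p * q)"
  by (simp add: mult.assoc flip: scalar_central)

lemma eta_zero: "eta 0 = 0"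
  using eta_add[of 0 0] by simp

lemma eta_diff: "eta (M - N) = eta M - eta N"
  using eta_add[of "M - N" N] by simp

section \<open>Evaluation of the free algebra on matrices\<close>

definition linear_extension :: "('w \<Rightarrow> rat) \<Rightarrow> ('w \<Rightarrow>\<^sub>0 rat) \<Rightarrow> rat" where
  "linear_extension f p = (\<Sum>w\<in>Poly_Mapping.keys p. Poly_Mapping.lookup p w * f w)"

lemma linear_extension_single: "linear_extension f (Poly_Mapping.single w c) = c * f w"
  by (simp add: linear_extension_def)

lemma linear_extension_add: "linear_extension f (p + q) = linear_extension f p + linear_extension f q"
  unfolding linear_extension_def
  by (rule setsum_keys_plus_distrib[of "\<lambda>w c. c * f w"]) (simp_all add: algebra_simps)

lemma linear_extension_zero: "linear_extension f 0 = 0"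
  by (simp add: linear_extension_def)

text \<open>
  The matrix that a word becomes when each symbol \<open>e\<^sub>i\<^sub>j\<close> is replaced by \<open>c E\<^sub>i\<^sub>j\<close>. Its linear extension
  \<open>evaluation c\<close> below is the algebra homomorphism that the universal property of the free algebra
  attaches to this replacement; it is built entry by entry because each entry is a linear functional.
\<close>

fun word_matrix :: "rat \<Rightarrow> (2 \<times> 2) list \<Rightarrow> rat^2^2" where
  "word_matrix c [] = mat 1"
| "word_matrix c ((i, j) # w) = (c \<odot>\<^bsub>mat2_alg\<^esub> matrix_unit i j) ** word_matrix c w"

lemma word_matrix_append: "word_matrix c (u @ v) = word_matrix c u ** word_matrix c v"
  by (induction c u rule: word_matrix.induct) (simp_all add: matrix_mul_assoc)

definition evaluation :: "rat \<Rightarrow> ((2 \<times> 2) list \<Rightarrow>\<^sub>0 rat) \<Rightarrow> rat^2^2" where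
  "evaluation c p = (\<chi> i j. linear_extension (\<lambda>w. word_matrix c w $ i $ j) p)"

lemma evaluation_zero: "evaluation c 0 = 0"
  by (simp add: evaluation_def vec_eq_iff linear_extension_zero)

lemma evaluation_add: "evaluation c (p + q) = evaluation c p + evaluation c q"
  by (simp add: evaluation_def vec_eq_iff linear_extension_add)

lemma evaluation_diff: "evaluation c (p - q) = evaluation c p - evaluation c q"
  using evaluation_add[of c "p - q" q] by simp

lemma evaluation_single:
  "evaluation c (Poly_Mapping.single w d) = d \<odot>\<^bsub>mat2_alg\<^esub> word_matrix c w"
  by (simp add: evaluation_def vec_eq_iff linear_extension_single smult_matrix_nth)

lemma evaluation_mult: "evaluation c (p * q) = evaluation c p ** evaluation c q"
proof (induction p rule: poly_mapping_single_induct)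
  case (single u a)
  show ?case
  proof (induction q rule: poly_mapping_single_induct)
    case (single v b)
    show ?case
      by (simp add: single_append[symmetric] evaluation_single word_matrix_append
          smult_matrix_mult_left smult_matrix_mult_right)
        (simp add: vec_eq_iff smult_matrix_nth)
  qed (simp_all add: evaluation_zero evaluation_add matrix_add_ldistrib algebra_simps)
qed (simp_all add: evaluation_zero evaluation_add matrix_mult_add_left algebra_simps)

lemma evaluation_scalar: "evaluation c (Poly_Mapping.single [] a) = a \<odot>\<^bsub>mat2_alg\<^esub> mat 1"
  by (simp add: evaluation_single)

lemma evaluation_smult: "evaluation c (a \<odot>\<^bsub>free_alg\<^esub> p) = a \<odot>\<^bsub>mat2_alg\<^esub> evaluation c p"
  by (simp add: smult_eq_mult evaluation_mult evaluation_scalar smult_matrix_mult_left)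

lemma evaluation_eta: "evaluation c (eta M) = c \<odot>\<^bsub>mat2_alg\<^esub> M"
proof (induction M rule: matrix_span_induct)
  case (unit i j)
  show ?case by (simp add: eta_matrix_unit symb_def evaluation_single smult_one_matrix)
qed (simp_all add: eta_add eta_smult evaluation_add evaluation_smult vec_eq_iff
    smult_matrix_nth algebra_simps)

text \<open>
  The constant term is the evaluation that sends every symbol to \<open>0\<close>: a product of words is empty
  only if both factors are. It will give the summand \<open>\<rat>\<close>.
\<close>

lemma constant_term_mult:
  fixes p q :: "'x list \<Rightarrow>\<^sub>0 rat"
  shows "Poly_Mapping.lookup (p * q) [] = Poly_Mapping.lookup p [] * Poly_Mapping.lookup q []"
proof (induction p rule: poly_mapping_single_induct)
  case (single u a)
  show ?case
  proof (induction q rule: poly_mapping_single_induct)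
    case (single v b)
    show ?case
      by (simp add: single_append[symmetric] lookup_single when_def)
  qed (simp_all add: lookup_add algebra_simps)
qed (simp_all add: lookup_add algebra_simps)

lemma constant_term_eta: "Poly_Mapping.lookup (eta M) [] = 0"
  by (simp add: eta_def lookup_sum lookup_free_smult symb_def lookup_single)

section \<open>Relations in the universal envelope\<close>

lemma ideal_special_comm: "ideal special_comm_ideal free_alg"
  unfolding special_comm_ideal_def
  by (rule ring.genideal_ideal[OF ring_free_alg]) (simp add: free_alg_def)

lemma special_comm_ideal_add:
  "p \<in> special_comm_ideal \<Longrightarrow> q \<in> special_comm_ideal \<Longrightarrow> p + q \<in> special_comm_ideal"
  using additive_subgroup.a_closed[OF ideal.axioms(1)[OF ideal_special_comm]]
  by (simp add: free_alg_def)

lemma special_comm_ideal_zero: "0 \<in> special_comm_ideal"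
  using additive_subgroup.zero_closed[OF ideal.axioms(1)[OF ideal_special_comm]]
  by (simp add: free_alg_def)

lemma special_comm_ideal_mult_left: "p \<in> special_comm_ideal \<Longrightarrow> q * p \<in> special_comm_ideal"
  using ideal.I_l_closed[OF ideal_special_comm, of p q] by (simp add: free_alg_def)

lemma special_comm_ideal_mult_right: "p \<in> special_comm_ideal \<Longrightarrow> p * q \<in> special_comm_ideal"
  using ideal.I_r_closed[OF ideal_special_comm, of p q] by (simp add: free_alg_def)

lemma special_comm_ideal_minus: "p \<in> special_comm_ideal \<Longrightarrow> - p \<in> special_comm_ideal"
  using special_comm_ideal_mult_left[of p "- 1"] by simp

text \<open>
  Equality in the universal envelope, expressed on representatives in the free algebra.
\<close>

definition envelope_cong ::
  "((2 \<times> 2) list \<Rightarrow>\<^sub>0 rat) \<Rightarrow> ((2 \<times> 2) list \<Rightarrow>\<^sub>0 rat) \<Rightarrow> bool"  (infix \<open>\<cong>\<^sub>U\<close> 50) where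
  "p \<cong>\<^sub>U q \<longleftrightarrow> p - q \<in> special_comm_ideal"

lemma cong_refl: "p \<cong>\<^sub>U p"
  by (simp add: envelope_cong_def special_comm_ideal_zero)

lemma cong_sym: "p \<cong>\<^sub>U q \<Longrightarrow> q \<cong>\<^sub>U p"
  using special_comm_ideal_minus[of "p - q"] by (simp add: envelope_cong_def)

lemma cong_trans [trans]: "p \<cong>\<^sub>U q \<Longrightarrow> q \<cong>\<^sub>U r \<Longrightarrow> p \<cong>\<^sub>U r"
  using special_comm_ideal_add[of "p - q" "q - r"] by (simp add: envelope_cong_def)

lemma cong_add: "p \<cong>\<^sub>U p' \<Longrightarrow> q \<cong>\<^sub>U q' \<Longrightarrow> p + q \<cong>\<^sub>U p' + q'"
  using special_comm_ideal_add[of "p - p'" "q - q'"] by (simp add: envelope_cong_def algebra_simps)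

lemma cong_diff: "p \<cong>\<^sub>U p' \<Longrightarrow> q \<cong>\<^sub>U q' \<Longrightarrow> p - q \<cong>\<^sub>U p' - q'"
  using special_comm_ideal_add[of "p - p'" "- (q - q')"] special_comm_ideal_minus[of "q - q'"]
  by (simp add: envelope_cong_def algebra_simps)

lemma cong_mult_left: "p \<cong>\<^sub>U q \<Longrightarrow> r * p \<cong>\<^sub>U r * q"
  using special_comm_ideal_mult_left[of "p - q" r] by (simp add: envelope_cong_def algebra_simps)

lemma cong_mult_right: "p \<cong>\<^sub>U q \<Longrightarrow> p * r \<cong>\<^sub>U q * r"
  using special_comm_ideal_mult_right[of "p - q" r] by (simp add: envelope_cong_def algebra_simps)

lemma cong_smult: "p \<cong>\<^sub>U q \<Longrightarrow> c \<odot>\<^bsub>free_alg\<^esub> p \<cong>\<^sub>U c \<odot>\<^bsub>free_alg\<^esub> q"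
  by (simp add: smult_eq_mult cong_mult_left)

lemma special_comm_eq: "special_comm x y z = (x ** y - y ** x) ** z"
  by (simp add: special_comm_def triple_def matrix_mult_diff_left)

text \<open>
  The ideal is generated by these relations for matrix units only; both sides are linear in each of
  \<open>x\<close>, \<open>y\<close> and \<open>z\<close>, so they follow for all matrices.
\<close>

lemma commutator_relation:
  "(eta x * eta y - eta y * eta x) * eta z \<cong>\<^sub>U eta ((x ** y - y ** x) ** z)"
proof -
  define R where "R x y z \<longleftrightarrow>
    (eta x * eta y - eta y * eta x) * eta z \<cong>\<^sub>U eta ((x ** y - y ** x) ** z)" for x y z
  have units: "R (matrix_unit i j) (matrix_unit k l) (matrix_unit s t)" for i j k l s t
  proof -
    have "symb i j * symb k l * symb s t - symb k l * symb i j * symb s t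
        - eta (special_comm (matrix_unit i j) (matrix_unit k l) (matrix_unit s t))
        \<in> special_comm_ideal"
      unfolding special_comm_ideal_def
      by (rule subsetD[OF ring.genideal_self[OF ring_free_alg]], simp add: free_alg_def) blast
    then show ?thesis
      by (simp add: R_def envelope_cong_def eta_matrix_unit special_comm_eq algebra_simps)
  qed
  note linear = eta_add eta_diff eta_smult smult_diff smult_add matrix_add_ldistrib
    matrix_mult_add_left matrix_mult_diff_left smult_matrix_mult_left smult_matrix_mult_right
    smult_mult_left smult_mult_right
  have "R x y z"
  proof (induction x rule: matrix_span_induct)
    case (add x x')
    then show ?case
      using cong_add[OF add[unfolded R_def]] by (simp add: R_def linear algebra_simps)
  next
    case (smult c x)
    then show ?case
      using cong_smult[OF smult[unfolded R_def], of c] by (simp add: R_def linear algebra_simps)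
  next
    case (unit i j)
    show ?case
    proof (induction y rule: matrix_span_induct)
      case (add y y')
      then show ?case
        using cong_add[OF add[unfolded R_def]] by (simp add: R_def linear algebra_simps)
    next
      case (smult c y)
      then show ?case
        using cong_smult[OF smult[unfolded R_def], of c] by (simp add: R_def linear algebra_simps)
    next
      case (unit k l)
      show ?case
      proof (induction z rule: matrix_span_induct)
        case (add z z')
        then show ?case
          using cong_add[OF add[unfolded R_def]] by (simp add: R_def linear algebra_simps)
      next
        case (smult c z)
        then show ?case
          using cong_smult[OF smult[unfolded R_def], of c] by (simp add: R_def linear algebra_simps)
      next
        case (unit s t)
        show ?case by (rule units)
      qed
    qed
  qed
  then show ?thesis by (simp add: R_def)
qed

text \<open>
  The identity commutes with \<open>x\<close>, so the defining relation for the pair \<open>1, x\<close> has right-hand side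
  \<open>0\<close>. The factor \<open>e z\<close> cannot be cancelled at this point.
\<close>

lemma eta_one_commutes_before_eta:
  "eta (mat 1) * eta x * eta z \<cong>\<^sub>U eta x * eta (mat 1) * eta z"
proof -
  have "(eta (mat 1) * eta x - eta x * eta (mat 1)) * eta z \<cong>\<^sub>U 0"
    using commutator_relation[of "mat 1" x z] by (simp add: eta_zero)
  then show ?thesis by (simp add: envelope_cong_def algebra_simps)
qed

text \<open>
  The product rule of the envelope. It is immediate for \<open>x = 1\<close>. For a commutator \<open>x = [a, b]\<close> the
  defining relation with third entry \<open>1\<close> produces a factor \<open>s\<close> directly in front of \<open>e c\<close>; since
  \<open>e c\<close> follows, \<open>s\<close> may be moved to the far left, and the defining relation is applied once more,
  with third entry \<open>c\<close>.
\<close>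

lemma eta_mult_eta: "eta x * eta c \<cong>\<^sub>U eta (mat 1) * eta (x ** c)"
proof -
  let ?s = "eta (mat 1)"
  note linear = eta_add eta_smult smult_add matrix_mult_add_left smult_matrix_mult_left
    smult_mult_left smult_mult_right
  show ?thesis
  proof (induction x rule: matrix_commutator_induct)
    case (add x y)
    then show ?case using cong_add[OF add] by (simp add: linear algebra_simps)
  next
    case (smult d x)
    then show ?case using cong_smult[OF smult] by (simp add: linear)
  next
    case one
    show ?case by (simp add: cong_refl)
  next
    case (commutator a b)
    have move: "?s * eta a * eta b * eta c \<cong>\<^sub>U eta a * eta b * ?s * eta c" for a b
    proof -
      have "?s * eta a * eta b * eta c \<cong>\<^sub>U eta a * ?s * eta b * eta c"
        by (intro cong_mult_right eta_one_commutes_before_eta)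
      also have "eta a * ?s * eta b * eta c \<cong>\<^sub>U eta a * eta b * ?s * eta c"
        using cong_mult_left[OF eta_one_commutes_before_eta[of b c], of "eta a"]
        by (simp add: mult.assoc)
      finally show ?thesis .
    qed
    have "eta (a ** b - b ** a) * eta c \<cong>\<^sub>U (eta a * eta b - eta b * eta a) * ?s * eta c"
      using cong_mult_right[OF cong_sym[OF commutator_relation[of a b "mat 1"]], of "eta c"]
      by simp
    also have "(eta a * eta b - eta b * eta a) * ?s * eta c
        \<cong>\<^sub>U ?s * ((eta a * eta b - eta b * eta a) * eta c)"
      using cong_sym[OF cong_diff[OF move[of a b] move[of b a]]] by (simp add: algebra_simps)
    also have "?s * ((eta a * eta b - eta b * eta a) * eta c)
        \<cong>\<^sub>U ?s * eta ((a ** b - b ** a) ** c)"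
      by (rule cong_mult_left[OF commutator_relation])
    finally show ?case .
  qed
qed

lemma eta_mult_eta_one: "eta x * eta (mat 1) \<cong>\<^sub>U eta (mat 1) * eta x"
  using eta_mult_eta[of x "mat 1"] by simp

text \<open>
  Two ways to evaluate \<open>[e a, e b] e c\<close> agree: the defining relation gives \<open>e ([a, b] c)\<close>, the
  product rule used twice gives \<open>s\<^sup>2 (e ([a, b] c))\<close>. Every matrix is of the form \<open>[a, b] c\<close>, because
  \<open>[E\<^sub>1\<^sub>2, E\<^sub>2\<^sub>1] = E\<^sub>1\<^sub>1 - E\<^sub>2\<^sub>2\<close> is its own inverse.
\<close>

lemma eta_one_square: "eta (mat 1) * eta (mat 1) * eta x \<cong>\<^sub>U eta x"
proof -
  let ?s = "eta (mat 1)"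
  have *: "?s * ?s * eta ((a ** b - b ** a) ** c) \<cong>\<^sub>U eta ((a ** b - b ** a) ** c)" for a b c
  proof -
    have "?s * ?s * eta ((a ** b - b ** a) ** c) \<cong>\<^sub>U ?s * (eta (a ** b - b ** a) * eta c)"
      using cong_mult_left[OF cong_sym[OF eta_mult_eta]] by (simp add: mult.assoc)
    also have "?s * (eta (a ** b - b ** a) * eta c)
        = (?s * eta (a ** b) - ?s * eta (b ** a)) * eta c"
      by (simp add: eta_diff algebra_simps)
    also have "\<dots> \<cong>\<^sub>U (eta a * eta b - eta b * eta a) * eta c"
      by (intro cong_mult_right cong_diff cong_sym[OF eta_mult_eta])
    also have "\<dots> \<cong>\<^sub>U eta ((a ** b - b ** a) ** c)"
      by (rule commutator_relation)
    finally show ?thesis .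
  qed
  define d where "d = matrix_unit 1 2 ** matrix_unit 2 1 - matrix_unit 2 1 ** matrix_unit 1 2"
  have "d ** d = mat 1"
    by (simp add: d_def matrix_unit_mult)
      (simp add: vec_eq_iff forall_2 matrix_matrix_mult_def matrix_unit_def mat_def sum_2)
  then have "d ** (d ** x) = x"
    by (simp add: matrix_mul_assoc)
  then show ?thesis
    using *[of "matrix_unit 1 2" "matrix_unit 2 1" "d ** x"] by (simp flip: d_def)
qed

text \<open>
  Left multiplication by a symbol preserves the shape \<open>\<alpha> + e x + s (e y)\<close>:
  \<open>(e z) (\<alpha> + e x + s (e y)) = e (\<alpha> z) + s (e (z x)) + s\<^sup>2 (e (z y))\<close>, and \<open>s\<^sup>2\<close> may be dropped.
  So the shape is reached for every word by induction on its length.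
\<close>

lemma normal_form:
  "\<exists>\<alpha> x y. p \<cong>\<^sub>U Poly_Mapping.single [] \<alpha> + eta x + eta (mat 1) * eta y"
proof (induction p rule: poly_mapping_single_induct)
  case zero
  have "0 \<cong>\<^sub>U Poly_Mapping.single [] 0 + eta 0 + eta (mat 1) * eta 0"
    by (simp add: eta_zero cong_refl)
  then show ?case by blast
next
  case (add p q)
  then obtain \<alpha> x y \<beta> x' y'
    where "p \<cong>\<^sub>U Poly_Mapping.single [] \<alpha> + eta x + eta (mat 1) * eta y"
      and "q \<cong>\<^sub>U Poly_Mapping.single [] \<beta> + eta x' + eta (mat 1) * eta y'"
    by blast
  from cong_add[OF this]
  have "p + q \<cong>\<^sub>U Poly_Mapping.single [] (\<alpha> + \<beta>) + eta (x + x') + eta (mat 1) * eta (y + y')"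
    by (simp add: single_add eta_add algebra_simps)
  then show ?case by blast
next
  case (single w c)
  show ?case
  proof (induction w)
    case Nil
    have "Poly_Mapping.single [] c \<cong>\<^sub>U Poly_Mapping.single [] c + eta 0 + eta (mat 1) * eta 0"
      by (simp add: eta_zero cong_refl)
    then show ?case by blast
  next
    case (Cons ij w)
    obtain i j where ij: "ij = (i, j)" by force
    let ?z = "matrix_unit i j" and ?s = "eta (mat 1)"
    from Cons obtain \<alpha> x y
      where w: "Poly_Mapping.single w c \<cong>\<^sub>U Poly_Mapping.single [] \<alpha> + eta x + ?s * eta y"
      by blast
    have "Poly_Mapping.single (ij # w) c = eta ?z * Poly_Mapping.single w c"
      using single_append[of "[ij]" w 1 c] by (simp add: ij eta_matrix_unit symb_def)
    also have "\<dots> \<cong>\<^sub>U eta ?z * (Poly_Mapping.single [] \<alpha> + eta x + ?s * eta y)"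
      by (rule cong_mult_left[OF w])
    also have "\<dots> = eta (\<alpha> \<odot>\<^bsub>mat2_alg\<^esub> ?z) + eta ?z * eta x + eta ?z * ?s * eta y"
      by (simp add: distrib_left scalar_central eta_smult mult.assoc)
    also have "\<dots> \<cong>\<^sub>U eta (\<alpha> \<odot>\<^bsub>mat2_alg\<^esub> ?z) + ?s * eta (?z ** x) + eta (?z ** y)"
    proof (intro cong_add cong_refl eta_mult_eta)
      have "eta ?z * ?s * eta y \<cong>\<^sub>U ?s * (eta ?z * eta y)"
        using cong_mult_right[OF eta_mult_eta_one] by (simp add: mult.assoc)
      also have "\<dots> \<cong>\<^sub>U ?s * ?s * eta (?z ** y)"
        using cong_mult_left[OF eta_mult_eta] by (simp add: mult.assoc)
      also have "\<dots> \<cong>\<^sub>U eta (?z ** y)"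
        by (rule eta_one_square)
      finally show "eta ?z * ?s * eta y \<cong>\<^sub>U eta (?z ** y)" .
    qed
    also have "\<dots> = Poly_Mapping.single [] 0 + eta (\<alpha> \<odot>\<^bsub>mat2_alg\<^esub> ?z + ?z ** y)
        + ?s * eta (?z ** x)"
      by (simp add: eta_add algebra_simps)
    finally show ?case by blast
  qed
qed

section \<open>The decomposition\<close>

abbreviation wedderburn_sum :: "(rat, rat \<times> (rat^2^2) \<times> (rat^2^2)) module" where
  "wedderburn_sum \<equiv> rat_alg \<oplus>\<^sub>a\<^sub>l\<^sub>g mat2_alg \<oplus>\<^sub>a\<^sub>l\<^sub>g mat2_alg"

lemma wedderburn_sum_simps:
  "carrier wedderburn_sum = UNIV"
  "one wedderburn_sum = (1, mat 1, mat 1)"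
  "zero wedderburn_sum = (0, 0, 0)"
  "mult wedderburn_sum (a, M, N) (a', M', N') = (a * a', M ** M', N ** N')"
  "add wedderburn_sum (a, M, N) (a', M', N') = (a + a', M + M', N + N')"
  "smult wedderburn_sum c (a, M, N) = (c * a, c \<odot>\<^bsub>mat2_alg\<^esub> M, c \<odot>\<^bsub>mat2_alg\<^esub> N)"
  by (simp_all add: sum_alg_def RDirProd_def DirProd_def rat_alg_def mat2_alg_def
      monoid.defs ring.defs)

lemma ring_wedderburn_sum: "ring wedderburn_sum"
proof (rule ringI)
  show "abelian_group wedderburn_sum"
    by (rule abelian_group_type)
      (auto simp: wedderburn_sum_simps zero_prod_def fun_eq_iff)
  show "Group.monoid wedderburn_sum"
    by (rule monoidI) (auto simp: wedderburn_sum_simps matrix_mul_assoc)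
qed (auto simp: wedderburn_sum_simps matrix_add_ldistrib matrix_mult_add_left algebra_simps)

definition wedderburn_map :: "((2 \<times> 2) list \<Rightarrow>\<^sub>0 rat) \<Rightarrow> rat \<times> (rat^2^2) \<times> (rat^2^2)" where
  "wedderburn_map p = (Poly_Mapping.lookup p [], evaluation 1 p, evaluation (- 1) p)"

lemma ring_hom_wedderburn: "ring_hom_ring free_alg wedderburn_sum wedderburn_map"
proof (rule ring_hom_ringI[OF ring_free_alg ring_wedderburn_sum])
  show "wedderburn_map \<one>\<^bsub>free_alg\<^esub> = \<one>\<^bsub>wedderburn_sum\<^esub>"
    using evaluation_scalar[of _ 1]
    by (simp add: wedderburn_map_def wedderburn_sum_simps free_alg_def smult_one_matrix
        flip: single_empty_one)
qed (simp_all add: wedderburn_map_def wedderburn_sum_simps free_alg_def evaluation_mult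
    evaluation_add constant_term_mult lookup_add)

lemma wedderburn_map_smult:
  "wedderburn_map (c \<odot>\<^bsub>free_alg\<^esub> p) = c \<odot>\<^bsub>wedderburn_sum\<^esub> wedderburn_map p"
  by (simp add: wedderburn_map_def wedderburn_sum_simps lookup_free_smult evaluation_smult)

text \<open>
  The first component is \<open>\<alpha>\<close>, half the difference of the last two is \<open>x\<close>, and half their sum is
  \<open>\<alpha> + y\<close>. So this formula yields both surjectivity and injectivity on normal forms.
\<close>

lemma wedderburn_map_normal_form:
  "wedderburn_map (Poly_Mapping.single [] \<alpha> + eta x + eta (mat 1) * eta y)
     = (\<alpha>, \<alpha> \<odot>\<^bsub>mat2_alg\<^esub> mat 1 + x + y, \<alpha> \<odot>\<^bsub>mat2_alg\<^esub> mat 1 - x + y)"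
  by (simp add: wedderburn_map_def lookup_add constant_term_eta constant_term_mult evaluation_add
      evaluation_mult evaluation_scalar evaluation_eta smult_matrix_mult_left)
    (simp add: vec_eq_iff smult_matrix_nth)

lemma wedderburn_map_surj: "surj wedderburn_map"
proof -
  have "\<exists>p. (a, M, N) = wedderburn_map p" for a M N
  proof
    let ?h = "\<lambda>M. (1/2) \<odot>\<^bsub>mat2_alg\<^esub> M"
    show "(a, M, N) = wedderburn_map (Poly_Mapping.single [] a + eta (?h (M - N))
        + eta (mat 1) * eta (?h (M + N) - a \<odot>\<^bsub>mat2_alg\<^esub> mat 1))"
      unfolding wedderburn_map_normal_form by (simp add: vec_eq_iff smult_matrix_nth field_simps)
  qed
  then show ?thesis by (auto simp: surj_def)
qed

text \<open>
  The generators of the ideal vanish under the evaluations because they have degree three in the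
  symbols on one side and degree one on the other, and \<open>c\<^sup>3 = c\<close> for \<open>c = 1\<close> and \<open>c = - 1\<close>;
  their constant term is \<open>0\<close>. Conversely an
  element of the kernel is congruent to a normal form that is also in the kernel, and the only such
  normal form is \<open>0\<close>.
\<close>

lemma wedderburn_kernel: "a_kernel free_alg wedderburn_sum wedderburn_map = special_comm_ideal"
proof
  interpret ring_hom_ring free_alg wedderburn_sum wedderburn_map
    by (rule ring_hom_wedderburn)
  have kernel: "p \<in> a_kernel free_alg wedderburn_sum wedderburn_map \<longleftrightarrow> wedderburn_map p = (0, 0, 0)" for p
    unfolding a_kernel_def' wedderburn_sum_simps by (simp add: free_alg_def)
  show ideal_le: "special_comm_ideal \<subseteq> a_kernel free_alg wedderburn_sum wedderburn_map"
    unfolding special_comm_ideal_def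
  proof (rule ring.genideal_minimal[OF ring_free_alg kernel_is_ideal], clarify)
    fix i j k l s t
    have "evaluation c (symb i j * symb k l * symb s t - symb k l * symb i j * symb s t
          - eta (special_comm (matrix_unit i j) (matrix_unit k l) (matrix_unit s t))) = 0"
      if "c * c = 1" for c
    proof -
      have cc: "c * (c * a) = a" for a
        by (simp add: that flip: mult.assoc)
      show ?thesis
        by (simp add: evaluation_diff evaluation_mult evaluation_eta special_comm_eq
            smult_matrix_mult_left smult_matrix_mult_right matrix_mult_diff_left
            flip: eta_matrix_unit)
          (simp add: vec_eq_iff smult_matrix_nth cc right_diff_distrib)
    qed
    then show "symb i j * symb k l * symb s t - symb k l * symb i j * symb s t
          - eta (special_comm (matrix_unit i j) (matrix_unit k l) (matrix_unit s t))
        \<in> a_kernel free_alg wedderburn_sum wedderburn_map"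
      unfolding kernel
      by (simp add: wedderburn_map_def lookup_minus constant_term_mult
          constant_term_eta flip: eta_matrix_unit)
  qed
  show "a_kernel free_alg wedderburn_sum wedderburn_map \<subseteq> special_comm_ideal"
  proof
    fix p assume p: "p \<in> a_kernel free_alg wedderburn_sum wedderburn_map"
    obtain \<alpha> x y where nf: "p \<cong>\<^sub>U Poly_Mapping.single [] \<alpha> + eta x + eta (mat 1) * eta y"
      (is "_ \<cong>\<^sub>U ?n")
      using normal_form by blast
    then have "p - ?n \<in> a_kernel free_alg wedderburn_sum wedderburn_map"
      using ideal_le by (auto simp: envelope_cong_def)
    with p have "wedderburn_map ?n = (0, 0, 0)"
      by (simp add: kernel wedderburn_map_def lookup_minus evaluation_diff)
    then have "\<alpha> = 0" and sum: "x + y = 0" and diff: "y - x = 0"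
      unfolding wedderburn_map_normal_form by (auto simp: vec_eq_iff smult_matrix_nth)
    moreover have "x = 0" "y = 0"
      using sum diff by (auto simp: vec_eq_iff)
    ultimately show "p \<in> special_comm_ideal"
      using nf by (simp add: envelope_cong_def eta_zero)
  qed
qed

theorem theorem7p5:
  shows "simple_alg rat_alg \<and> simple_alg mat2_alg \<and>
    alg_isomorphic universal_envelope (rat_alg \<oplus>\<^sub>a\<^sub>l\<^sub>g mat2_alg \<oplus>\<^sub>a\<^sub>l\<^sub>g mat2_alg)"
proof (intro conjI simple_alg_rat simple_alg_mat2)
  interpret ring_hom_ring free_alg wedderburn_sum wedderburn_map
    by (rule ring_hom_wedderburn)
  define f where "f = (\<lambda>X. the_elem (wedderburn_map ` X))"
  have "f \<in> ring_iso (free_alg Quot special_comm_ideal) wedderburn_sum"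
    using FactRing_iso_set wedderburn_map_surj
    unfolding f_def wedderburn_kernel by (simp add: free_alg_def wedderburn_sum_simps)
  then have "f \<in> ring_iso universal_envelope wedderburn_sum"
    by (simp add: universal_envelope_def quot_alg_def ring_iso_def ring_hom_def ring.defs)
  moreover have "f (c \<odot>\<^bsub>universal_envelope\<^esub> X) = c \<odot>\<^bsub>wedderburn_sum\<^esub> f X"
    if "X \<in> carrier universal_envelope" for c X
  proof -
    from that have "X \<in> carrier (free_alg Quot special_comm_ideal)"
      by (simp add: universal_envelope_def quot_alg_def ring.defs)
    then obtain p where "wedderburn_map ` X = {wedderburn_map p}"
      using the_elem_wf' unfolding wedderburn_kernel by blast
    then have const: "wedderburn_map x = wedderburn_map p" if "x \<in> X" for x
      using that by blast
    \<comment> \<open>Scalar multiplication on the quotient is a union over all representatives of \<open>X\<close>; the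
      map takes the same value on every one of them.\<close>
    have "X \<noteq> {}"
      using \<open>wedderburn_map ` X = {wedderburn_map p}\<close> by blast
    have coset: "wedderburn_map ` (special_comm_ideal +>\<^bsub>free_alg\<^esub> q) = {wedderburn_map q}" for q
    proof -
      have "k \<in> special_comm_ideal \<Longrightarrow> wedderburn_map (k + q) = wedderburn_map q" for k
        using wedderburn_kernel
        by (auto simp: a_kernel_def' wedderburn_sum_simps wedderburn_map_def evaluation_add lookup_add)
      then show ?thesis
        using special_comm_ideal_zero by (auto simp: a_r_coset_def' free_alg_def image_iff)
    qed
    have "wedderburn_map ` (c \<odot>\<^bsub>universal_envelope\<^esub> X)
        = (\<Union>x\<in>X. {wedderburn_map (c \<odot>\<^bsub>free_alg\<^esub> x)})"
      by (simp add: universal_envelope_def quot_alg_def ring.defs image_UN coset)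
    also have "\<dots> = {c \<odot>\<^bsub>wedderburn_sum\<^esub> wedderburn_map p}"
      using \<open>X \<noteq> {}\<close> by (auto simp: wedderburn_map_smult const)
    finally show ?thesis
      by (simp add: f_def \<open>wedderburn_map ` X = {wedderburn_map p}\<close>)
  qed
  ultimately show "alg_isomorphic universal_envelope wedderburn_sum"
    unfolding alg_isomorphic_def alg_iso_def by blast
qed

end
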